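(* Let $k\ge 2$ and $m\ge 2$ be integers, and let $\lambda$ be a root of $P^k_m$ that is not a root of $P^k_j$ for any $1\le j<m$. Then, as $r\to\infty$, the proportion of eigenvalues (counted with multiplicity) of the adjacency operator of $X_r^k$ that are equal to $\lambda$, i.e. the multiplicity of $\lambda$ divided by the number of nodes of $X_r^k$, converges to $$\frac{(k-1)^2}{k^m-1}.$$
   Context: $X_r^k$ denotes the $k$-ary rooted tree of depth $r$: a finite tree with a distinguished root in which every node at distance less than $r$ from the root has exactly $k$ children (neighbours one step farther from the root), and the nodes at distance $r$ from the root are the leaves (degree 1). The adjacency operator acts on complex-valued functions on the nodes by $(Av)_\gamma=\sum_{\beta\sim\gamma}v_\beta$. The polynomials $P^k_n(x)$ are defined by $P^k_0(x)=0$, $P^k_1(x)=1$, and $P^k_n(x)=xP^k_{n-1}(x)-kP^k_{n-2}(x)$ for $n\ge 2$. *)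

theory Defs
  imports Complex_Main
    "HOL-Library.Function_Algebras"
    "HOL-Computational_Algebra.Polynomial"
begin

fun tree_poly :: "nat \<Rightarrow> nat \<Rightarrow> complex poly" where
  "tree_poly k 0 = 0"
| "tree_poly k (Suc 0) = 1"
| "tree_poly k (Suc (Suc n)) = [:0, 1:] * tree_poly k (Suc n) - smult (of_nat k) (tree_poly k n)"

text \<open>
  Concrete model of the \<open>k\<close>-ary rooted tree of depth \<open>r\<close>: the nodes are the words of length at most
  \<open>r\<close> over \<open>{..<k}\<close>, the root is \<open>[]\<close>, and the children of \<open>xs\<close> are the words \<open>i # xs\<close>, so that
  the length of a word is its distance from the root.
\<close>

definition tree_nodes :: "nat \<Rightarrow> nat \<Rightarrow> nat list set" where
  "tree_nodes k r = {xs. set xs \<subseteq> {..<k} \<and> length xs \<le> r}"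

definition tree_adj :: "nat list \<Rightarrow> nat list \<Rightarrow> bool" where
  "tree_adj xs ys \<longleftrightarrow> (\<exists>i. ys = i # xs) \<or> (\<exists>i. xs = i # ys)"

lemma finite_tree_nodes: "finite (tree_nodes k r)"
  unfolding tree_nodes_def by (rule finite_lists_length_le) simp

lemma tree_adj_sym: "tree_adj xs ys \<longleftrightarrow> tree_adj ys xs"
  by (auto simp: tree_adj_def)

lemma tree_adj_irrefl: "\<not> tree_adj xs xs"
  by (auto simp: tree_adj_def)

lemma tree_adj_length: "tree_adj xs ys \<Longrightarrow> length ys = Suc (length xs) \<or> length xs = Suc (length ys)"
  by (auto simp: tree_adj_def)

lemma children_eq:
  assumes "xs \<in> tree_nodes k r" "length xs < r"
  shows "{ys \<in> tree_nodes k r. tree_adj xs ys \<and> length ys = Suc (length xs)} = (\<lambda>i. i # xs) ` {..<k}"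
proof (intro equalityI subsetI)
  fix ys assume ys: "ys \<in> {ys \<in> tree_nodes k r. tree_adj xs ys \<and> length ys = Suc (length xs)}"
  then have "tree_adj xs ys" "length ys = Suc (length xs)" by simp_all
  then obtain i where i: "ys = i # xs"
    by (auto simp: tree_adj_def)
  with ys have "i < k" by (simp add: tree_nodes_def)
  with i show "ys \<in> (\<lambda>i. i # xs) ` {..<k}" by simp
next
  fix ys assume "ys \<in> (\<lambda>i. i # xs) ` {..<k}"
  then obtain i where "i < k" "ys = i # xs" by blast
  with assms show "ys \<in> {ys \<in> tree_nodes k r. tree_adj xs ys \<and> length ys = Suc (length xs)}"
    by (simp add: tree_nodes_def tree_adj_def)
qed

lemma card_children:
  assumes "xs \<in> tree_nodes k r" "length xs < r"
  shows "card {ys \<in> tree_nodes k r. tree_adj xs ys \<and> length ys = Suc (length xs)} = k"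
proof -
  have "inj_on (\<lambda>i. i # xs) {..<k}" by (rule inj_onI) simp
  then show ?thesis unfolding children_eq[OF assms] by (simp only: card_image card_lessThan)
qed

lemma ex1_parent:
  assumes "xs \<in> tree_nodes k r" "xs \<noteq> []"
  shows "\<exists>!ys. ys \<in> tree_nodes k r \<and> tree_adj xs ys \<and> length xs = Suc (length ys)"
proof (rule ex1I)
  show "tl xs \<in> tree_nodes k r \<and> tree_adj xs (tl xs) \<and> length xs = Suc (length (tl xs))"
    using assms by (cases xs) (simp_all add: tree_nodes_def tree_adj_def)
next
  fix ys assume "ys \<in> tree_nodes k r \<and> tree_adj xs ys \<and> length xs = Suc (length ys)"
  then have "tree_adj xs ys" "length xs = Suc (length ys)" by simp_all
  then show "ys = tl xs" by (auto simp: tree_adj_def)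
qed

text \<open>
  Complex-valued functions on a node set \<open>V\<close> are represented by functions on the whole type that
  vanish outside \<open>V\<close>, which makes them a complex subspace.
\<close>

definition functions_on :: "'a set \<Rightarrow> ('a \<Rightarrow> complex) set" where
  "functions_on V = {v. \<forall>x. x \<notin> V \<longrightarrow> v x = 0}"

definition adjacency_op ::
    "'a set \<Rightarrow> ('a \<Rightarrow> 'a \<Rightarrow> bool) \<Rightarrow> ('a \<Rightarrow> complex) \<Rightarrow> ('a \<Rightarrow> complex)" where
  "adjacency_op V E v = (\<lambda>x. if x \<in> V then \<Sum>y\<in>{y \<in> V. E x y}. v y else 0)"

abbreviation scale_fun :: "complex \<Rightarrow> ('a \<Rightarrow> complex) \<Rightarrow> ('a \<Rightarrow> complex)" where
  "scale_fun c v \<equiv> (\<lambda>x. c * v x)"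

global_interpretation cfun: vector_space scale_fun
  by unfold_locales (auto simp: fun_eq_iff algebra_simps)

definition adj_eigenspace ::
    "'a set \<Rightarrow> ('a \<Rightarrow> 'a \<Rightarrow> bool) \<Rightarrow> complex \<Rightarrow> ('a \<Rightarrow> complex) set" where
  "adj_eigenspace V E l = {v \<in> functions_on V. adjacency_op V E v = scale_fun l v}"

text \<open>
  The multiplicity of an eigenvalue is the complex dimension of its eigenspace (and \<open>0\<close> for
  numbers that are not eigenvalues). For a symmetric relation on a finite set the operator is
  self-adjoint, so there is no difference between geometric and algebraic multiplicity.
\<close>

definition adj_multiplicity :: "'a set \<Rightarrow> ('a \<Rightarrow> 'a \<Rightarrow> bool) \<Rightarrow> complex \<Rightarrow> nat" where
  "adj_multiplicity V E l = cfun.dim (adj_eigenspace V E l)"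

end

theory Submission
  imports Defs
begin

text \<open>
  Write \<open>p n\<close> for \<open>P\<^sup>k\<^sub>n(\<lambda>)\<close>, and let the height of a node be its distance to the leaves. By induction
  from the leaves upwards, an eigenfunction \<open>v\<close> satisfies \<open>p (h + 2) * v x = p (h + 1) * v (parent x)\<close>
  at every node \<open>x\<close> of height \<open>h\<close>, where the parent of the root contributes \<open>0\<close>. So \<open>v x\<close> is
  determined by the parent unless \<open>p (h + 2) = 0\<close>; in that case \<open>v\<close> vanishes at the parent, and the
  only constraint on the \<open>k\<close> siblings is that their sum is minus the value at the grandparent. Each
  node \<open>y\<close> with \<open>p (height y + 1) = 0\<close> thus contributes \<open>k - 1\<close> to the multiplicity, and the root
  contributes \<open>1\<close> if \<open>p (r + 2) = 0\<close>. Since \<open>p n = 0\<close> exactly for the multiples \<open>n\<close> of \<open>m\<close>,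
  a geometric sum gives the limit.
\<close>

section \<open>Dimension of a space of functions from a dual family\<close>

lemma sum_fun_apply: "(\<Sum>a\<in>A. f a) x = (\<Sum>a\<in>A. f a x :: 'b::comm_monoid_add)"
  by (induction A rule: infinite_finite_induct) auto

text \<open>Restriction to \<open>B\<close> maps \<open>W\<close> linearly to the functions on
  \<open>B\<close>: \<open>zero\<close> makes it injective and \<open>dual\<close> makes it
  surjective, so the \<open>e b\<close> form a basis.\<close>

lemma dim_eq_card_dual_family:
  fixes W :: "('a \<Rightarrow> complex) set"
  assumes "finite B" and W: "cfun.subspace W"
    and e: "\<And>b. b \<in> B \<Longrightarrow> e b \<in> W"
    and dual: "\<And>b c. b \<in> B \<Longrightarrow> c \<in> B \<Longrightarrow> e b c = (if b = c then 1 else 0)"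
    and zero: "\<And>w. w \<in> W \<Longrightarrow> (\<And>b. b \<in> B \<Longrightarrow> w b = 0) \<Longrightarrow> w = 0"
  shows "cfun.dim W = card B"
proof (rule cfun.dim_unique)
  have inj: "inj_on e B"
    by (rule inj_onI) (metis dual one_neq_zero)
  show "e ` B \<subseteq> W"
    using e by blast
  show "card (e ` B) = card B"
    by (rule card_image[OF inj])
  have comb: "(\<Sum>b\<in>B. scale_fun (u b) (e b)) c = u c" if "c \<in> B" for u c
    using that \<open>finite B\<close>
    by (simp add: sum_fun_apply dual if_distrib cong: if_cong)
  show "\<not> cfun.dependent (e ` B)"
  proof
    assume "cfun.dependent (e ` B)"
    then obtain u where u: "\<exists>v\<in>e ` B. u v \<noteq> 0" "(\<Sum>v\<in>e ` B. scale_fun (u v) v) = 0"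
      using cfun.dependent_finite[of "e ` B"] \<open>finite B\<close> by auto
    have "(\<Sum>b\<in>B. scale_fun (u (e b)) (e b)) = 0"
      using u(2) by (simp add: sum.reindex[OF inj])
    then have "u (e c) = 0" if "c \<in> B" for c
      using comb[OF that, of "\<lambda>b. u (e b)"] by simp
    with u(1) show False by blast
  qed
  show "W \<subseteq> cfun.span (e ` B)"
  proof
    fix w assume w: "w \<in> W"
    let ?s = "\<Sum>b\<in>B. scale_fun (w b) (e b)"
    have "?s \<in> W"
      using e W by (intro cfun.subspace_sum) (auto intro: cfun.subspace_scale)
    then have "w - ?s \<in> W"
      using w W cfun.subspace_diff by blast
    then have "w - ?s = 0"
      by (rule zero) (simp add: comb)
    then have "w = ?s" by simp
    moreover have "?s \<in> cfun.span (e ` B)"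
      by (intro cfun.span_sum cfun.span_scale cfun.span_base) auto
    ultimately show "w \<in> cfun.span (e ` B)" by simp
  qed
qed

section \<open>The eigenvalue equation on the tree\<close>

lemma subspace_adj_eigenspace: "cfun.subspace (adj_eigenspace V E l)"
  by (auto simp: cfun.subspace_def adj_eigenspace_def functions_on_def adjacency_op_def fun_eq_iff
      sum.distrib algebra_simps simp flip: sum_distrib_left)

text \<open>The value 0 above the root lets one equation cover the root and all other nodes.\<close>

definition parent_val :: "(nat list \<Rightarrow> complex) \<Rightarrow> nat list \<Rightarrow> complex" where
  "parent_val v x = (case x of [] \<Rightarrow> 0 | _ # y \<Rightarrow> v y)"

lemma parent_val_simps [simp]: "parent_val v [] = 0" "parent_val v (i # y) = v y"
  by (simp_all add: parent_val_def)

lemma tree_nodes_Cons: "i # y \<in> tree_nodes k r \<longleftrightarrow> i < k \<and> length y < r \<and> y \<in> tree_nodes k r"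
  by (auto simp: tree_nodes_def)

lemma adjacency_op_tree:
  assumes "x \<in> tree_nodes k r"
  shows "adjacency_op (tree_nodes k r) tree_adj v x
           = (if length x < r then \<Sum>i<k. v (i # x) else 0) + parent_val v x"
proof -
  let ?C = "if length x < r then (\<lambda>i. i # x) ` {..<k} else {}"
  let ?P = "case x of [] \<Rightarrow> {} | _ # y \<Rightarrow> {y}"
  have eq: "{y \<in> tree_nodes k r. tree_adj x y} = ?C \<union> ?P"
    using assms by (auto simp: tree_adj_def tree_nodes_def split: list.splits)
  have disj: "?C \<inter> ?P = {}"
    by (auto split: list.splits)
  have "(\<Sum>y\<in>?C \<union> ?P. v y) = sum v ?C + sum v ?P"
    using disj by (intro sum.union_disjoint) (auto split: list.splits)
  moreover have "sum v ?C = (if length x < r then \<Sum>i<k. v (i # x) else 0)"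
    by (simp add: sum.reindex inj_on_def)
  moreover have "sum v ?P = parent_val v x"
    by (cases x) simp_all
  ultimately show ?thesis
    using assms by (simp add: adjacency_op_def eq)
qed

lemma adj_eigenspace_tree_iff:
  "v \<in> adj_eigenspace (tree_nodes k r) tree_adj l \<longleftrightarrow>
     (\<forall>x. x \<notin> tree_nodes k r \<longrightarrow> v x = 0) \<and>
     (\<forall>x \<in> tree_nodes k r.
        l * v x = (if length x < r then \<Sum>i<k. v (i # x) else 0) + parent_val v x)"
    (is "?L \<longleftrightarrow> ?R")
proof
  assume v: ?L
  show ?R
  proof (intro conjI ballI allI impI)
    fix x assume "x \<notin> tree_nodes k r"
    then show "v x = 0" using v by (simp add: adj_eigenspace_def functions_on_def)
  next
    fix x assume x: "x \<in> tree_nodes k r"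
    have "adjacency_op (tree_nodes k r) tree_adj v x = l * v x"
      using v by (simp add: adj_eigenspace_def)
    then show "l * v x = (if length x < r then \<Sum>i<k. v (i # x) else 0) + parent_val v x"
      unfolding adjacency_op_tree[OF x] by simp
  qed
next
  assume v: ?R
  have "adjacency_op (tree_nodes k r) tree_adj v x = l * v x" for x
  proof (cases "x \<in> tree_nodes k r")
    case True
    then show ?thesis unfolding adjacency_op_tree[OF True] using v by simp
  next
    case False
    then show ?thesis using v by (simp add: adjacency_op_def)
  qed
  then show ?L using v by (auto simp: adj_eigenspace_def functions_on_def)
qed

text \<open>Multiplying the eigenvalue equation at \<open>x\<close> by \<open>p (h + 2)\<close> and
  inserting the relation at each child produces the recurrence for \<open>p (h + 3)\<close>. With
  the depth written as \<open>length x + h\<close>, passing to a child lowers the height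
  \<open>h\<close> but keeps the tree.\<close>

lemma tree_eigenvector_parent:
  assumes v: "v \<in> adj_eigenspace (tree_nodes k (length x + h)) tree_adj l"
    and "x \<in> tree_nodes k (length x + h)"
  shows "poly (tree_poly k (h + 2)) l * v x = poly (tree_poly k (h + 1)) l * parent_val v x"
  using assms
proof (induction h arbitrary: x)
  case 0
  then have "l * v x = parent_val v x" unfolding adj_eigenspace_tree_iff by auto
  then show ?case by (simp add: numeral_2_eq_2)
next
  case (Suc h)
  let ?p = "\<lambda>n. poly (tree_poly k n) l"
  have "?p (h + 2) * v (i # x) = ?p (h + 1) * v x" if "i < k" for i
    using Suc.IH[of "i # x"] Suc.prems that by (simp add: tree_nodes_Cons)
  then have "?p (h + 2) * (\<Sum>i<k. v (i # x)) = of_nat k * (?p (h + 1) * v x)"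
    by (simp add: sum_distrib_left)
  moreover have "l * v x = (\<Sum>i<k. v (i # x)) + parent_val v x"
    using Suc.prems unfolding adj_eigenspace_tree_iff by auto
  ultimately have "?p (h + 2) * (l * v x) = of_nat k * (?p (h + 1) * v x) + ?p (h + 2) * parent_val v x"
    by (simp add: distrib_left)
  then show ?case by (simp add: algebra_simps)
qed

section \<open>Eigenfunctions from values at free nodes\<close>

lemma tree_poly_no_consecutive_roots:
  assumes "k > 0" "poly (tree_poly k n) l = 0"
  shows "poly (tree_poly k (Suc n)) l \<noteq> 0"
  using assms by (induction n) auto

declare tree_poly.simps(3) [simp del]

text \<open>
  The values at these nodes are free parameters for the eigenfunctions: among siblings, the first
  one is fixed by the eigenvalue equation at the parent.
\<close>

definition free_nodes :: "nat \<Rightarrow> complex \<Rightarrow> nat \<Rightarrow> nat list set" where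
  "free_nodes k l r = {x \<in> tree_nodes k r.
     poly (tree_poly k (r - length x + 2)) l = 0 \<and> (x = [] \<or> hd x \<noteq> 0)}"

text \<open>Builds an eigenfunction from the root downwards. For a node \<open>i # y\<close> of
  height \<open>h\<close>, the index \<open>r - length y + 1\<close> is \<open>h + 2\<close>. The
  last case solves the eigenvalue equation at \<open>y\<close> for the first child, the value at
  \<open>y\<close> being 0 there.\<close>

fun extend_free :: "nat \<Rightarrow> complex \<Rightarrow> nat \<Rightarrow> (nat list \<Rightarrow> complex) \<Rightarrow> nat list \<Rightarrow> complex" where
  "extend_free k l r g [] = (if poly (tree_poly k (r + 2)) l = 0 then g [] else 0)"
| "extend_free k l r g (i # y) =
     (if poly (tree_poly k (r - length y + 1)) l \<noteq> 0
      then poly (tree_poly k (r - length y)) l / poly (tree_poly k (r - length y + 1)) l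
             * extend_free k l r g y
      else if i \<noteq> 0 then g (i # y)
      else - (case y of [] \<Rightarrow> 0 | _ # z \<Rightarrow> extend_free k l r g z) - (\<Sum>j=1..<k. g (j # y)))"

text \<open>As \<open>p (h + 2)\<close> is then nonzero, a non-root \<open>x\<close> falls under the
  quotient case, with numerator \<open>p (h + 1) = 0\<close>; the root gets 0 directly.\<close>

lemma extend_free_eq_0:
  assumes "k > 0" "length x < r" "poly (tree_poly k (r - length x + 1)) l = 0"
  shows "extend_free k l r g x = 0"
proof -
  have "poly (tree_poly k (r - length x + 2)) l \<noteq> 0"
    using tree_poly_no_consecutive_roots[OF assms(1,3)] by simp
  with assms show ?thesis by (cases x) (simp_all add: Suc_diff_Suc)
qed

lemma extend_free_parent:
  assumes k: "k > 0" and "x \<in> tree_nodes k r"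
  shows "poly (tree_poly k (r - length x + 2)) l * extend_free k l r g x
           = poly (tree_poly k (r - length x + 1)) l * parent_val (extend_free k l r g) x"
proof (cases x)
  case Nil
  then show ?thesis by simp
next
  case (Cons i y)
  with assms have y: "length y < r" by (simp add: tree_nodes_Cons)
  then have *: "r - length x + 2 = r - length y + 1" "r - length x + 1 = r - length y"
    using Cons by auto
  show ?thesis
  proof (cases "poly (tree_poly k (r - length y + 1)) l = 0")
    \<comment> \<open>The left side is 0 by the case assumption, the right side because the parent
      vanishes.\<close>
    case True
    then show ?thesis unfolding * using extend_free_eq_0[OF k y True] Cons by simp
  next
    case False
    then show ?thesis unfolding * using Cons by simp
  qed
qed

lemma extend_free_eigenvector:
  assumes "k > 0"
  shows "(\<lambda>x. if x \<in> tree_nodes k r then extend_free k l r g x else 0)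
           \<in> adj_eigenspace (tree_nodes k r) tree_adj l" (is "?w \<in> _")
  unfolding adj_eigenspace_tree_iff
proof (intro conjI ballI allI impI)
  fix x assume "x \<notin> tree_nodes k r"
  then show "?w x = 0" by simp
next
  fix x assume x: "x \<in> tree_nodes k r"
  let ?v = "extend_free k l r g" and ?p = "\<lambda>n. poly (tree_poly k n) l"
  define h where "h = r - length x"
  have par: "parent_val ?w x = parent_val ?v x"
    using x by (cases x) (simp_all add: tree_nodes_Cons)
  have child: "?w (i # x) = ?v (i # x)" if "i < k" "length x < r" for i
    using that x by (simp add: tree_nodes_Cons)
  have "l * ?v x = (if length x < r then \<Sum>i<k. ?v (i # x) else 0) + parent_val ?v x"
  proof (cases "?p (h + 1) = 0")
    case True
    \<comment> \<open>At a leaf \<open>p (h + 1)\<close> would be \<open>p 1 = 1\<close>.\<close>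
    then have len: "length x < r"
      unfolding h_def by (cases "length x < r") auto
    have "(\<Sum>i<k. ?v (i # x)) = ?v (0 # x) + (\<Sum>i=1..<k. ?v (i # x))"
      using \<open>k > 0\<close> by (simp add: lessThan_atLeast0 sum.atLeast_Suc_lessThan)
    also have "(\<Sum>i=1..<k. ?v (i # x)) = (\<Sum>i=1..<k. g (i # x))"
      using True by (intro sum.cong) (auto simp: h_def)
    also have "?v (0 # x) + \<dots> = - parent_val ?v x"
      using True by (simp add: h_def parent_val_def)
    finally show ?thesis
      using len extend_free_eq_0[OF \<open>k > 0\<close> len] True by (simp add: h_def)
  next
    case False
    \<comment> \<open>It suffices to check the equation multiplied by \<open>p (h + 1)\<close>. This
      formula also covers leaves, where the sum is absent and \<open>p h = p 0 = 0\<close>.\<close>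
    have "?p (h + 1) * (if length x < r then \<Sum>i<k. ?v (i # x) else 0) = of_nat k * ?p h * ?v x"
    proof (cases "length x < r")
      case True
      have "?p (h + 1) * ?v (i # x) = ?p h * ?v x" for i
        using False by (simp add: h_def)
      then show ?thesis using True by (simp add: sum_distrib_left)
    next
      case False
      then show ?thesis by (simp add: h_def)
    qed
    moreover have "?p (h + 2) * ?v x = ?p (h + 1) * parent_val ?v x"
      using extend_free_parent[OF \<open>k > 0\<close> x] by (simp add: h_def)
    moreover have "?p (h + 1) * (l * ?v x) = of_nat k * ?p h * ?v x + ?p (h + 2) * ?v x"
      by (simp add: tree_poly.simps(3) algebra_simps)
    ultimately have "?p (h + 1) * (l * ?v x)
      = ?p (h + 1) * ((if length x < r then \<Sum>i<k. ?v (i # x) else 0) + parent_val ?v x)"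
      by (simp only: distrib_left)
    then show ?thesis
      using False by (metis mult_left_cancel)
  qed
  then show "l * ?w x = (if length x < r then \<Sum>i<k. ?w (i # x) else 0) + parent_val ?w x"
    using x child unfolding par by (auto cong: if_cong)
qed

lemma extend_free_on_free_nodes:
  assumes "x \<in> free_nodes k l r"
  shows "extend_free k l r g x = g x"
  using assms
  by (cases x) (auto simp: free_nodes_def tree_nodes_Cons Suc_diff_Suc)

lemma eigenvector_eq_0_of_free_nodes:
  assumes "k > 0" and v: "v \<in> adj_eigenspace (tree_nodes k r) tree_adj l"
    and zero: "\<And>x. x \<in> free_nodes k l r \<Longrightarrow> v x = 0"
  shows "v = 0"
proof -
  let ?p = "\<lambda>n. poly (tree_poly k n) l"
  have par: "?p (r - length x + 2) * v x = ?p (r - length x + 1) * parent_val v x"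
    if "x \<in> tree_nodes k r" for x
    using tree_eigenvector_parent[of v k x "r - length x" l] v that by (simp add: tree_nodes_def)
  \<comment> \<open>Induction from the root downwards, so the parent and grandparent values are
    already 0.\<close>
  have "v x = 0" if "x \<in> tree_nodes k r" for x
    using that
  proof (induction "length x" arbitrary: x rule: less_induct)
    case less
    have pv: "parent_val v x = 0"
      using less.hyps less.prems by (cases x) (auto simp: tree_nodes_Cons)
    show ?case
    proof (cases "?p (r - length x + 2) = 0 \<and> x \<notin> free_nodes k l r")
      case False
      then show ?thesis using par[OF less.prems] pv zero by auto
    next
      case True
      \<comment> \<open>Only a first child can fail to be free here. Its siblings are free, so they
        vanish, and the equation at \<open>y\<close> forces \<open>v x = 0\<close>.\<close>
      then obtain y where x: "x = 0 # y"
        using less.prems by (cases x) (auto simp: free_nodes_def)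
      with less.prems have y: "y \<in> tree_nodes k r" "length y < r"
        by (auto simp: tree_nodes_Cons)
      have "v (i # y) = 0" if "i \<in> {1..<k}" for i
      proof (rule zero)
        show "i # y \<in> free_nodes k l r"
          using that True y unfolding x by (auto simp: free_nodes_def tree_nodes_Cons)
      qed
      then have "(\<Sum>i<k. v (i # y)) = v x"
        using \<open>k > 0\<close> by (simp add: x lessThan_atLeast0 sum.atLeast_Suc_lessThan)
      moreover have "l * v y = (\<Sum>i<k. v (i # y)) + parent_val v y"
        using v y unfolding adj_eigenspace_tree_iff by auto
      moreover have "parent_val v y = 0"
        using less.hyps y unfolding x by (cases y) (auto simp: tree_nodes_Cons)
      moreover have "v y = 0"
        using pv x by simp
      ultimately show ?thesis by simp
    qed
  qed
  moreover have "v x = 0" if "x \<notin> tree_nodes k r" for x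
    using v that unfolding adj_eigenspace_tree_iff by blast
  ultimately show ?thesis by (auto simp: fun_eq_iff)
qed

section \<open>The multiplicity as a number of free nodes\<close>

lemma adj_multiplicity_tree:
  assumes "k > 0"
  shows "adj_multiplicity (tree_nodes k r) tree_adj l = card (free_nodes k l r)"
  unfolding adj_multiplicity_def
proof (rule dim_eq_card_dual_family)
  let ?e = "\<lambda>b x. if x \<in> tree_nodes k r
                    then extend_free k l r (\<lambda>c. if b = c then 1 else 0) x else 0"
  show "finite (free_nodes k l r)"
    by (simp add: free_nodes_def finite_tree_nodes)
  show "?e b \<in> adj_eigenspace (tree_nodes k r) tree_adj l" for b
    by (rule extend_free_eigenvector[OF assms])
  show "?e b c = (if b = c then 1 else 0)" if "c \<in> free_nodes k l r" for b c
    using that extend_free_on_free_nodes[OF that] by (simp add: free_nodes_def)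
qed (use assms eigenvector_eq_0_of_free_nodes subspace_adj_eigenspace in blast)+

text \<open>Non-root free nodes are grouped by the depth \<open>d\<close> of their parent: there are
  \<open>k ^ d\<close> parents, each with \<open>k - 1\<close> children of nonzero label, and these
  have height \<open>r - d - 1\<close>.\<close>

lemma card_free_nodes:
  "card (free_nodes k l r) =
    (k - 1) * (\<Sum>d | d < Suc r \<and> poly (tree_poly k (Suc r - d)) l = 0. k ^ d)
      + (if poly (tree_poly k (r + 2)) l = 0 then 1 else 0)"
proof -
  let ?p = "\<lambda>n. poly (tree_poly k n) l"
  let ?D = "{d. d < Suc r \<and> ?p (Suc r - d) = 0}"
  let ?W = "\<lambda>d. {y. set y \<subseteq> {..<k} \<and> length y = d}"
  let ?R = "if ?p (r + 2) = 0 then {[]} else ({} :: nat list set)"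
  let ?S = "(\<lambda>(d, y, i). i # y) ` (SIGMA d:?D. ?W d \<times> {1..<k})"
  \<comment> \<open>The index \<open>d = r\<close> is excluded by \<open>p 1 = 1\<close>, so leaves
    do not count as parents.\<close>
  have D: "d < r" if "d \<in> ?D" for d
    using that by (cases "d = r") auto
  have "free_nodes k l r = ?S \<union> ?R"
  proof (rule set_eqI)
    fix x
    show "x \<in> free_nodes k l r \<longleftrightarrow> x \<in> ?S \<union> ?R"
    proof (cases x)
      case Nil
      then show ?thesis by (auto simp: free_nodes_def tree_nodes_def)
    next
      case (Cons i y)
      have "x \<in> ?S \<longleftrightarrow> length y \<in> ?D \<and> y \<in> ?W (length y) \<and> i \<in> {1..<k}"
        using Cons by (auto simp: image_iff)
      moreover have "r - length x + 2 = Suc r - length y" if "length y < r"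
        using that Cons by auto
      ultimately show ?thesis
        using Cons D[of "length y"]
        by (auto simp: free_nodes_def tree_nodes_def)
    qed
  qed
  moreover have finS: "finite (SIGMA d:?D. ?W d \<times> {1..<k})"
    by (intro finite_SigmaI finite_cartesian_product finite_lists_length_eq) auto
  moreover have "card ?S = (k - 1) * (\<Sum>d\<in>?D. k ^ d)"
  proof -
    have "card ?S = card (SIGMA d:?D. ?W d \<times> {1..<k})"
      by (rule card_image) (auto simp: inj_on_def)
    also have "\<dots> = (\<Sum>d\<in>?D. k ^ d * (k - 1))"
      by (subst card_SigmaI) (auto simp: card_cartesian_product card_lists_length_eq
          intro!: finite_cartesian_product finite_lists_length_eq)
    finally show ?thesis by (simp add: sum_distrib_left mult.commute)
  qed
  moreover have "?S \<inter> ?R = {}" by auto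
  moreover have "finite ?R" "card ?R = (if ?p (r + 2) = 0 then 1 else 0)" by auto
  ultimately show ?thesis
    by (simp only: card_Un_disjoint finite_imageI)
qed

section \<open>Zeros of the polynomial sequence and the geometric sum\<close>

lemma tree_poly_root_iff_dvd:
  assumes "k > 0" "m > 0" and root: "poly (tree_poly k m) l = 0"
    and min: "\<And>j. 1 \<le> j \<Longrightarrow> j < m \<Longrightarrow> poly (tree_poly k j) l \<noteq> 0"
  shows "poly (tree_poly k n) l = 0 \<longleftrightarrow> m dvd n"
proof -
  let ?p = "\<lambda>n. poly (tree_poly k n) l"
  \<comment> \<open>After a zero at \<open>m\<close> the sequence restarts, scaled by
    \<open>p (m + 1)\<close>: both sides obey the same recurrence and agree at \<open>n = 0\<close>
    and \<open>n = 1\<close>. Two consecutive indices are carried for the induction.\<close>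
  have shift: "?p (m + n) = ?p (Suc m) * ?p n \<and> ?p (m + Suc n) = ?p (Suc m) * ?p (Suc n)" for n
    by (induction n) (auto simp: root tree_poly.simps(3) algebra_simps)
  have neq: "?p (Suc m) \<noteq> 0"
    using tree_poly_no_consecutive_roots assms by blast
  show ?thesis
  proof (induction n rule: less_induct)
    case (less n)
    show ?case
    proof (cases "n < m")
      case True
      then show ?thesis
        using min[of n] by (cases "n = 0") (auto dest: dvd_imp_le)
    next
      case False
      then have "n = m + (n - m)" by simp
      then have "?p n = 0 \<longleftrightarrow> ?p (n - m) = 0"
        using shift[of "n - m"] neq by (metis mult_eq_0_iff)
      then show ?thesis
        using less[of "n - m"] False \<open>m > 0\<close> by (simp add: dvd_minus_self)
    qed
  qed
qed

text \<open>For \<open>n >= m\<close> the exponents are \<open>n - m\<close>,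
  \<open>n - 2 * m\<close>, down to \<open>n mod m\<close>. The induction from \<open>n - m\<close>
  to \<open>n\<close> adds the largest one.\<close>

lemma sum_powers_codivisible:
  fixes k m n :: nat
  assumes "m > 0"
  shows "(real k ^ m - 1) * (\<Sum>d | d < n \<and> m dvd (n - d). real k ^ d) = real k ^ n - real k ^ (n mod m)"
proof (induction n rule: less_induct)
  case (less n)
  show ?case
  proof (cases "n < m")
    case True
    then have none: "{d. d < n \<and> m dvd (n - d)} = {}"
      by (auto dest: dvd_imp_le)
    show ?thesis unfolding none using True by simp
  next
    case False
    define q where "q = n - m"
    have n: "n = q + m" using False by (simp add: q_def)
    have "{d. d < n \<and> m dvd (n - d)} = insert q {d. d < q \<and> m dvd (q - d)}"
    proof (rule set_eqI)
      fix d
      consider "d < q" | "d = q" | "d > q" by linarith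
      then show "d \<in> {d. d < n \<and> m dvd (n - d)} \<longleftrightarrow> d \<in> insert q {d. d < q \<and> m dvd (q - d)}"
      proof cases
        case 1
        then have "n - d = (q - d) + m" using n by simp
        then have "m dvd (n - d) \<longleftrightarrow> m dvd (q - d)" by simp
        with 1 show ?thesis by (simp add: n)
      next
        case 2
        with \<open>m > 0\<close> show ?thesis by (simp add: n)
      next
        case 3
        then have "\<not> m dvd (n - d)" if "d < n"
          using that n by (auto dest: dvd_imp_le)
        with 3 show ?thesis by auto
      qed
    qed
    moreover have "(real k ^ m - 1) * (\<Sum>d | d < q \<and> m dvd (q - d). real k ^ d)
        = real k ^ q - real k ^ (q mod m)"
      using less[of q] n \<open>m > 0\<close> by simp
    ultimately show ?thesis
      by (simp add: n power_add algebra_simps)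
  qed
qed

section \<open>The limit of the proportion\<close>

lemma card_tree_nodes: "(real k - 1) * real (card (tree_nodes k r)) = real k ^ Suc r - 1"
  unfolding tree_nodes_def
  by (simp add: card_lists_length_le geometric_sum power_diff_1_eq lessThan_Suc_atMost
      del: power_Suc)

theorem theorem2:
  fixes k m :: nat and lam :: complex
  assumes "k \<ge> 2" and "m \<ge> 2"
    and "poly (tree_poly k m) lam = 0"
    and "\<And>j. 1 \<le> j \<Longrightarrow> j < m \<Longrightarrow> poly (tree_poly k j) lam \<noteq> 0"
  shows "(\<lambda>r. real (adj_multiplicity (tree_nodes k r) tree_adj lam) / real (card (tree_nodes k r)))
           \<longlonglongrightarrow> (real k - 1)^2 / (real k ^ m - 1)"
proof -
  define L where "L = (real k - 1)^2 / (real k ^ m - 1)"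
  define b where "b r = real k ^ (Suc r mod m)" for r
  define \<epsilon> :: "nat \<Rightarrow> real" where "\<epsilon> r = (if m dvd r + 2 then 1 else 0)" for r
  \<comment> \<open>The proportion is exactly \<open>L + c r / (k ^ (r + 1) - 1)\<close>:
    \<open>b r\<close> is the end term of the geometric sum and \<open>\<epsilon> r\<close> the
    contribution of the root.\<close>
  define c where "c r = L * (1 - b r) + (real k - 1) * \<epsilon> r" for r
  have km: "real k ^ m > 1" and kr: "real k ^ Suc r > 1" for r
    using assms by (auto intro!: one_less_power simp del: power_Suc)
  have dvd: "poly (tree_poly k n) lam = 0 \<longleftrightarrow> m dvd n" for n
    using assms by (intro tree_poly_root_iff_dvd) auto
  have quot: "real (adj_multiplicity (tree_nodes k r) tree_adj lam) / real (card (tree_nodes k r))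
      = L + c r * inverse (real k ^ Suc r - 1)" for r
  proof -
    let ?T = "\<Sum>d | d < Suc r \<and> m dvd (Suc r - d). real k ^ d"
    have mult: "real (adj_multiplicity (tree_nodes k r) tree_adj lam) = (real k - 1) * ?T + \<epsilon> r"
      using assms by (simp add: adj_multiplicity_tree card_free_nodes dvd \<epsilon>_def of_nat_diff)
    define K Q where "K = real k ^ Suc r - 1" and "Q = real k ^ m - 1"
    have nz: "K \<noteq> 0" "Q \<noteq> 0" "real k - 1 \<noteq> 0"
      using less_imp_neq[OF km] less_imp_neq[OF kr[of r]] assms
      by (auto simp: K_def Q_def simp del: power_Suc)
    have "Q * ?T = K + 1 - b r"
      using sum_powers_codivisible[of m k "Suc r"] assms
      by (simp add: K_def Q_def b_def del: power_Suc)
    then have T: "?T = (K + 1 - b r) / Q"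
      using nz by (simp add: field_simps)
    have N: "real (card (tree_nodes k r)) = K / (real k - 1)"
      using card_tree_nodes[of k r] nz by (simp add: K_def field_simps)
    show ?thesis
      unfolding mult T N c_def L_def K_def[symmetric] Q_def[symmetric]
      using nz by (simp add: field_simps power2_eq_square)
  qed
  \<comment> \<open>The exponent in \<open>b r\<close> stays below \<open>m\<close> and
    \<open>\<epsilon> r\<close> is 0 or 1, so the error is a bounded sequence times a null
    sequence.\<close>
  have "Bseq c"
  proof (rule BseqI')
    fix r
    have "1 \<le> b r" "b r \<le> real k ^ m"
      using assms unfolding b_def by (auto intro!: one_le_power power_increasing)
    then have "\<bar>1 - b r\<bar> \<le> real k ^ m" by simp
    moreover have "\<bar>\<epsilon> r\<bar> \<le> 1" by (simp add: \<epsilon>_def)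
    ultimately have "\<bar>L\<bar> * \<bar>1 - b r\<bar> \<le> \<bar>L\<bar> * real k ^ m" "\<bar>real k - 1\<bar> * \<bar>\<epsilon> r\<bar> \<le> \<bar>real k - 1\<bar> * 1"
      by (blast intro: mult_left_mono abs_ge_zero)+
    then show "norm (c r) \<le> \<bar>L\<bar> * real k ^ m + \<bar>real k - 1\<bar>"
      unfolding c_def real_norm_def
      by (intro order_trans[OF abs_triangle_ineq]) (simp add: abs_mult)
  qed
  moreover have "(\<lambda>r. inverse (real k ^ Suc r - 1)) \<longlonglongrightarrow> 0"
  proof (rule filterlim_compose[OF tendsto_inverse_0])
    have "filterlim (\<lambda>r. real k ^ r) at_infinity sequentially"
      using assms by (intro filterlim_realpow_sequentially_gt1) auto
    then have "filterlim (\<lambda>r. real k ^ Suc r) at_infinity sequentially"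
      by (rule filterlim_compose[OF _ filterlim_Suc])
    then have "filterlim (\<lambda>r. - 1 + real k ^ Suc r) at_infinity sequentially"
      by (rule tendsto_add_filterlim_at_infinity[OF tendsto_const])
    then show "filterlim (\<lambda>r. real k ^ Suc r - 1) at_infinity sequentially"
      by simp
  qed
  ultimately have "(\<lambda>r. c r * inverse (real k ^ Suc r - 1)) \<longlonglongrightarrow> 0"
    by (simp only: tendsto_Zfun_iff diff_0_right
        bounded_bilinear.Bfun_prod_Zfun[OF bounded_bilinear_mult])
  then show ?thesis
    unfolding quot L_def[symmetric] by (auto intro: tendsto_eq_intros)
qed

end
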